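(* There exists a constant $c>0$ such that the following holds. There is $\epsilon_0>0$ such that for every $0<\epsilon<\epsilon_0$ there is $d_0(\epsilon)$ such that for all integers $d\ge d_0(\epsilon)$ and all positive integers $k<\frac{cd}{\epsilon^2}$, there exist vectors $v_1,\dots,v_n\in\mathbb{R}^d$ ($n\ge k$) for which $$\mathrm{CP}_E>(1+\epsilon)\,\mathrm{OPT}_E=(1+\epsilon)\max_{S\subseteq[n],|S|=k}\lambda_{\min}\Big(\sum_{i\in S}v_iv_i^\top\Big).$$
   Context: $\lambda_{\min}$ denotes the smallest eigenvalue. $\mathrm{CP}_E$ is the optimal value of the convex relaxation of E-optimal design: maximize $\lambda_{\min}\big(\sum_{i=1}^nx_iv_iv_i^\top\big)$ subject to $\sum_ix_i=k$, $0\le x_i\le1$. *)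

theory Defs
  imports Complex_Main "Jordan_Normal_Form.Char_Poly"
begin

text \<open>The dimension \<open>d\<close> is quantified inside the statement, so vectors of
  \<open>\<real>\<^sup>d\<close> are elements of \<^term>\<open>carrier_vec d\<close>.\<close>

text \<open>Meant for real symmetric square matrices of positive dimension, which have a finite
  nonempty set of eigenvalues.\<close>

definition lambda_min :: "real mat \<Rightarrow> real" where
  "lambda_min A = Min {e. eigenvalue A e}"

text \<open>\<open>\<Sum>i\<in>S. x i v\<^sub>i v\<^sub>i\<^sup>T\<close>, entrywise: the type of matrices of all
  sizes has no zero element, so \<^const>\<open>sum\<close> is not available on it.\<close>

definition weighted_gram :: "nat \<Rightarrow> nat set \<Rightarrow> (nat \<Rightarrow> real) \<Rightarrow> (nat \<Rightarrow> real vec) \<Rightarrow> real mat" where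
  "weighted_gram d S x v = mat d d (\<lambda>(a, b). \<Sum>i\<in>S. x i * (v i $ a * v i $ b))"

definition OPT_E :: "nat \<Rightarrow> nat \<Rightarrow> nat \<Rightarrow> (nat \<Rightarrow> real vec) \<Rightarrow> real" where
  "OPT_E d k n v = Max {lambda_min (weighted_gram d S (\<lambda>_. 1) v) | S. S \<subseteq> {1..n} \<and> card S = k}"

definition CP_E :: "nat \<Rightarrow> nat \<Rightarrow> nat \<Rightarrow> (nat \<Rightarrow> real vec) \<Rightarrow> real" where
  "CP_E d k n v = Sup {lambda_min (weighted_gram d {1..n} x v) | x.
     (\<Sum>i = 1..n. x i) = real k \<and> (\<forall>i\<in>{1..n}. 0 \<le> x i \<and> x i \<le> 1)}"

end

theory Submission
  imports Defs
begin

text \<open>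
  Take the differences \<open>e\<^sub>u - e\<^sub>w\<close> for all pairs \<open>w < u < d\<close> together with the all-ones vector.
  Their Gram matrix is \<open>d\<close> times the identity, so the uniform fractional solution has value about
  \<open>2k/d\<close>. An integral solution is a graph with at most \<open>k\<close> edges plus possibly the
  all-ones vector, and its value is at most the spectral gap of the graph Laplacian.

  Such a gap \<open>\<tau>\<close> cannot be close to the average degree \<open>D\<close>. All degrees are essentially at least
  \<open>\<tau>\<close>, so if \<open>\<gamma>\<close> bounds the average excess over \<open>\<tau>\<close>, most vertices and most edges are
  among the vertices of degree at most \<open>\<tau> + 4\<gamma>\<close>. Testing the Laplacian on stars around these
  vertices, with weight \<open>1\<close> at the centre and \<open>1/(4\<gamma>)\<close> at the leaves, and summing over the centres
  forces \<open>\<gamma>\<^sup>2\<close> to be at least a constant times \<open>\<tau>\<close>. Since \<open>\<gamma>\<close> is about \<open>\<epsilon>\<tau>\<close> when the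
  integrality gap is at most \<open>1 + \<epsilon>\<close>, this bounds \<open>D\<close> below by a constant times \<open>1/\<epsilon>\<^sup>2\<close>.
\<close>

section \<open>The least eigenvalue of a symmetric matrix\<close>

lemma quadratic_form_eq_sum:
  fixes A :: "real mat"
  assumes "A \<in> carrier_mat n n" "x \<in> carrier_vec n"
  shows "x \<bullet> (A *\<^sub>v x) = (\<Sum>a<n. \<Sum>b<n. A $$ (a, b) * (x $ a * x $ b))"
proof -
  have "x \<bullet> (A *\<^sub>v x) = (\<Sum>a<n. x $ a * (\<Sum>b<n. A $$ (a, b) * x $ b))"
    using assms by (auto simp: scalar_prod_def atLeast0LessThan intro!: sum.cong)
  then show ?thesis
    by (simp add: sum_distrib_left mult_ac)
qed

text \<open>Each product of two coordinates is at most \<open>x \<bullet> x\<close> in absolute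
  value, so the sum of the absolute entries serves as \<open>C\<close>. The added 1 keeps it
  positive for the zero matrix.\<close>

lemma quadratic_form_bounded:
  fixes A :: "real mat"
  assumes A: "A \<in> carrier_mat n n"
  shows "\<exists>C>0. \<forall>x\<in>carrier_vec n. \<bar>x \<bullet> (A *\<^sub>v x)\<bar> \<le> C * (x \<bullet> x)"
proof (intro exI conjI ballI)
  let ?C = "1 + (\<Sum>a<n. \<Sum>b<n. \<bar>A $$ (a, b)\<bar>)"
  show "0 < ?C"
    by (smt (verit) sum_nonneg abs_ge_zero)
  fix x :: "real vec" assume x: "x \<in> carrier_vec n"
  have xx: "x \<bullet> x = (\<Sum>a<n. (x $ a)\<^sup>2)"
    using x by (simp add: scalar_prod_def atLeast0LessThan power2_eq_square)
  have le: "(x $ a)\<^sup>2 \<le> x \<bullet> x" if "a < n" for a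
    unfolding xx using that by (intro member_le_sum) auto
  have prod: "\<bar>x $ a * x $ b\<bar> \<le> x \<bullet> x" if "a < n" "b < n" for a b
  proof -
    have "2 * \<bar>x $ a * x $ b\<bar> \<le> (x $ a)\<^sup>2 + (x $ b)\<^sup>2"
      using sum_squares_bound[of "\<bar>x $ a\<bar>" "\<bar>x $ b\<bar>"] by (simp add: abs_mult)
    then show ?thesis using le[OF that(1)] le[OF that(2)] by linarith
  qed
  have "\<bar>x \<bullet> (A *\<^sub>v x)\<bar> \<le> (\<Sum>a<n. \<Sum>b<n. \<bar>A $$ (a, b)\<bar> * (x \<bullet> x))"
    unfolding quadratic_form_eq_sum[OF A x]
    by (intro order_trans[OF sum_abs] sum_mono)
      (auto simp: abs_mult[of "A $$ _"] intro!: mult_left_mono prod)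
  also have "\<dots> = (\<Sum>a<n. \<Sum>b<n. \<bar>A $$ (a, b)\<bar>) * (x \<bullet> x)"
    by (simp add: sum_distrib_right)
  also have "\<dots> \<le> ?C * (x \<bullet> x)"
    by (intro mult_right_mono) (auto simp: xx sum_nonneg)
  finally show "\<bar>x \<bullet> (A *\<^sub>v x)\<bar> \<le> ?C * (x \<bullet> x)" .
qed

text \<open>Evaluating the nonnegative form at \<open>C x - M x\<close>, with \<open>C\<close>
  bounding the form of \<open>M\<close>, gives the estimate. It turns invertibility of a
  semidefinite matrix into a positive lower bound for its form without using a spectral
  decomposition.\<close>

lemma psd_norm_mult_bounded:
  fixes M :: "real mat"
  assumes M: "M \<in> carrier_mat n n" and sym: "M\<^sup>T = M"
    and psd: "\<And>x. x \<in> carrier_vec n \<Longrightarrow> 0 \<le> x \<bullet> (M *\<^sub>v x)"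
  shows "\<exists>C>0. \<forall>x\<in>carrier_vec n. (M *\<^sub>v x) \<bullet> (M *\<^sub>v x) \<le> C * (x \<bullet> (M *\<^sub>v x))"
proof -
  obtain C where C: "C > 0" "\<And>x. x \<in> carrier_vec n \<Longrightarrow> \<bar>x \<bullet> (M *\<^sub>v x)\<bar> \<le> C * (x \<bullet> x)"
    using quadratic_form_bounded[OF M] by blast
  have "(M *\<^sub>v x) \<bullet> (M *\<^sub>v x) \<le> C * (x \<bullet> (M *\<^sub>v x))" if x: "x \<in> carrier_vec n" for x
  proof -
    define y where "y = M *\<^sub>v x"
    have y: "y \<in> carrier_vec n" and My: "M *\<^sub>v y \<in> carrier_vec n"
      using M x by (auto simp: y_def)
    have xMy: "x \<bullet> (M *\<^sub>v y) = y \<bullet> y"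
      using transpose_vec_mult_scalar[OF M y x] by (simp add: sym y_def)
    define z where "z = C \<cdot>\<^sub>v x - y"
    have z: "z \<in> carrier_vec n" using x y by (simp add: z_def)
    have Mz: "M *\<^sub>v z = C \<cdot>\<^sub>v y - M *\<^sub>v y"
      using M x y unfolding z_def
      by (subst mult_minus_distrib_mat_vec[of _ n n]) (auto simp: mult_mat_vec y_def)
    have "0 \<le> z \<bullet> (M *\<^sub>v z)" using psd[OF z] .
    also have "\<dots> = C\<^sup>2 * (x \<bullet> y) - 2 * C * (y \<bullet> y) + y \<bullet> (M *\<^sub>v y)"
      unfolding Mz using x y My
      by (simp add: z_def minus_scalar_prod_distrib[of _ n] scalar_prod_minus_distrib[of _ n]
          xMy power2_eq_square algebra_simps)
    also have "\<dots> \<le> C\<^sup>2 * (x \<bullet> y) - C * (y \<bullet> y)"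
      using C(2)[OF y] by linarith
    finally have "C * (y \<bullet> y) \<le> C * (C * (x \<bullet> y))"
      by (simp add: power2_eq_square mult_ac)
    then show ?thesis using C(1) by (simp add: y_def)
  qed
  with C(1) show ?thesis by blast
qed

text \<open>The largest lower bound \<open>\<mu>\<close> of the Rayleigh quotient is an eigenvalue: if \<open>A - \<mu>\<close> were invertible,
  it would be bounded below by a positive multiple of the identity, and \<open>\<mu>\<close> could be increased.\<close>

lemma symmetric_least_eigenvalue:
  fixes A :: "real mat"
  assumes A: "A \<in> carrier_mat n n" and sym: "A\<^sup>T = A" and n: "0 < n"
  shows "\<exists>\<mu>. eigenvalue A \<mu> \<and> (\<forall>x\<in>carrier_vec n. \<mu> * (x \<bullet> x) \<le> x \<bullet> (A *\<^sub>v x))"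
proof -
  define T where "T = {m. \<forall>x\<in>carrier_vec n. m * (x \<bullet> x) \<le> x \<bullet> (A *\<^sub>v x)}"
  define \<mu> where "\<mu> = Sup T"
  have nonneg: "0 \<le> x \<bullet> x" for x :: "real vec"
    by (simp add: scalar_prod_def sum_nonneg)
  obtain C where C: "\<And>x. x \<in> carrier_vec n \<Longrightarrow> \<bar>x \<bullet> (A *\<^sub>v x)\<bar> \<le> C * (x \<bullet> x)"
    using quadratic_form_bounded[OF A] by blast
  have "- C \<in> T"
    using C by (force simp: T_def)
  then have ne: "T \<noteq> {}" by blast
  let ?e = "unit_vec n 0 :: real vec"
  have bdd: "bdd_above T"
  proof (rule bdd_aboveI)
    fix m assume "m \<in> T"
    then have "m * (?e \<bullet> ?e) \<le> ?e \<bullet> (A *\<^sub>v ?e)" by (simp add: T_def)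
    then show "m \<le> ?e \<bullet> (A *\<^sub>v ?e)" using n by simp
  qed
  have \<mu>: "\<mu> * (x \<bullet> x) \<le> x \<bullet> (A *\<^sub>v x)" if x: "x \<in> carrier_vec n" for x
  proof (cases "x \<bullet> x = 0")
    case True
    then show ?thesis using C[OF x] by simp
  next
    case False
    then have pos: "0 < x \<bullet> x" using nonneg[of x] by linarith
    have "\<mu> \<le> (x \<bullet> (A *\<^sub>v x)) / (x \<bullet> x)"
      unfolding \<mu>_def using ne x pos
      by (intro cSup_least) (auto simp: T_def pos_le_divide_eq)
    then show ?thesis using pos by (simp add: pos_le_divide_eq)
  qed
  define M where "M = char_matrix A \<mu>"
  have M: "M \<in> carrier_mat n n" using A by (simp add: M_def)
  have symA: "A $$ (i, j) = A $$ (j, i)" if "i < n" "j < n" for i j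
    using arg_cong[OF sym, of "\<lambda>B. B $$ (i, j)"] A that by auto
  have symM: "M\<^sup>T = M"
    by (rule eq_matI) (use A in \<open>auto simp: M_def char_matrix_def symA\<close>)
  have Mx: "M *\<^sub>v x = A *\<^sub>v x - \<mu> \<cdot>\<^sub>v x" if "x \<in> carrier_vec n" for x
    using A that unfolding M_def char_matrix_def
    by (subst add_mult_distrib_mat_vec[of _ n n]) auto
  have xMx: "x \<bullet> (M *\<^sub>v x) = x \<bullet> (A *\<^sub>v x) - \<mu> * (x \<bullet> x)" if "x \<in> carrier_vec n" for x
    using A that by (simp add: Mx scalar_prod_minus_distrib[of _ n])
  have "det M = 0"
  proof (rule ccontr)
    assume "det M \<noteq> 0"
    from det_non_zero_imp_unit[OF M this, of "()"] obtain B
      where B: "B \<in> carrier_mat n n" "B * M = 1\<^sub>m n"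
      by (auto simp: Units_def ring_mat_simps)
    have BB: "B\<^sup>T * B \<in> carrier_mat n n" using B by auto
    obtain K where K: "K > 0"
      "\<And>x. x \<in> carrier_vec n \<Longrightarrow> \<bar>x \<bullet> ((B\<^sup>T * B) *\<^sub>v x)\<bar> \<le> K * (x \<bullet> x)"
      using quadratic_form_bounded[OF BB] by blast
    obtain C' where C': "C' > 0"
      "\<And>x. x \<in> carrier_vec n \<Longrightarrow> (M *\<^sub>v x) \<bullet> (M *\<^sub>v x) \<le> C' * (x \<bullet> (M *\<^sub>v x))"
      using psd_norm_mult_bounded[OF M symM] xMx \<mu> by (metis diff_ge_0_iff_ge)
    \<comment> \<open>With \<open>B\<close> the inverse of \<open>M\<close>,
      \<open>x \<bullet> x\<close> is at most \<open>K\<close> times the squared norm of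
      \<open>M x\<close>, hence at most \<open>K * C'\<close> times the form of \<open>M\<close> at
      \<open>x\<close>.\<close>
    have "\<mu> + 1 / (K * C') \<in> T"
      unfolding T_def
    proof (intro CollectI ballI)
      fix x :: "real vec" assume x: "x \<in> carrier_vec n"
      define y where "y = M *\<^sub>v x"
      have y: "y \<in> carrier_vec n" using M x by (simp add: y_def)
      have By: "B *\<^sub>v y = x"
        unfolding y_def using assoc_mult_mat_vec[OF B(1) M x] B(2) x by simp
      have "x \<bullet> x = y \<bullet> ((B\<^sup>T * B) *\<^sub>v y)"
        using transpose_vec_mult_scalar[of "B\<^sup>T" n n x y] B(1) x y
        by (simp add: By)
      also have "\<dots> \<le> K * (y \<bullet> y)" using K(2)[OF y] by linarith
      also have "\<dots> \<le> K * (C' * (x \<bullet> (M *\<^sub>v x)))"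
        using C'(2)[OF x] K(1) by (simp add: y_def)
      finally show "(\<mu> + 1 / (K * C')) * (x \<bullet> x) \<le> x \<bullet> (A *\<^sub>v x)"
        using K(1) C'(1) by (simp add: xMx[OF x] field_simps)
    qed
    then have "\<mu> + 1 / (K * C') \<le> \<mu>"
      unfolding \<mu>_def using bdd by (rule cSup_upper)
    with K(1) C'(1) show False by (simp add: field_simps)
  qed
  then have "eigenvalue A \<mu>"
    unfolding eigenvalue_det[OF A] M_def .
  with \<mu> show ?thesis by blast
qed

lemma finite_eigenvalues:
  fixes A :: "real mat"
  assumes A: "A \<in> carrier_mat n n"
  shows "finite {e. eigenvalue A e}"
proof -
  have "char_poly A \<noteq> 0"
    using degree_monic_char_poly[OF A] by auto
  then show ?thesis
    unfolding eigenvalue_root_char_poly[OF A] by (rule poly_roots_finite)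
qed

text \<open>Some eigenvalue bounds the Rayleigh quotient from below, and \<open>lambda_min A\<close>
  is at most that eigenvalue.\<close>

lemma lambda_min_le_rayleigh:
  assumes A: "A \<in> carrier_mat n n" and sym: "A\<^sup>T = A" and x: "x \<in> carrier_vec n"
  shows "lambda_min A * (x \<bullet> x) \<le> x \<bullet> (A *\<^sub>v x)"
\<comment> \<open>In dimension 0 there are no eigenvalues and \<open>lambda_min A\<close> is the
  \<open>Min\<close> of the empty set, but both scalar products vanish.\<close>
proof (cases "n = 0")
  case True
  with A x show ?thesis by (simp add: scalar_prod_def)
next
  case False
  then obtain \<mu> where \<mu>: "eigenvalue A \<mu>" "\<forall>x\<in>carrier_vec n. \<mu> * (x \<bullet> x) \<le> x \<bullet> (A *\<^sub>v x)"
    using symmetric_least_eigenvalue[OF A sym] by blast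
  have "lambda_min A \<le> \<mu>"
    unfolding lambda_min_def using \<mu>(1) finite_eigenvalues[OF A] by (intro Min_le) auto
  then have "lambda_min A * (x \<bullet> x) \<le> \<mu> * (x \<bullet> x)"
    by (intro mult_right_mono) (auto simp: scalar_prod_def sum_nonneg)
  with \<mu>(2) x show ?thesis by fastforce
qed

lemma lambda_min_smult_one:
  assumes "0 < n"
  shows "lambda_min (c \<cdot>\<^sub>m 1\<^sub>m n) = c"
proof -
  have eq: "(c \<cdot>\<^sub>m 1\<^sub>m n) *\<^sub>v x = c \<cdot>\<^sub>v x" if "x \<in> carrier_vec n" for x :: "real vec"
    using that by auto
  have "eigenvalue (c \<cdot>\<^sub>m 1\<^sub>m n) e \<longleftrightarrow> e = c" for e
  proof
    assume "eigenvalue (c \<cdot>\<^sub>m 1\<^sub>m n) e"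
    then obtain x where x: "x \<in> carrier_vec n" "x \<noteq> 0\<^sub>v n" "c \<cdot>\<^sub>v x = e \<cdot>\<^sub>v x"
      unfolding eigenvalue_def eigenvector_def using eq by auto
    then obtain i where i: "i < n" "x $ i \<noteq> 0" by (metis eq_vecI carrier_vecD index_zero_vec)
    have "c * x $ i = e * x $ i"
      using arg_cong[OF x(3), of "\<lambda>y. y $ i"] x(1) i(1) by simp
    with i show "e = c" by simp
  next
    assume "e = c"
    moreover have "unit_vec n 0 \<noteq> (0\<^sub>v n :: real vec)"
      using assms by (metis index_unit_vec(2) index_zero_vec(1) zero_neq_one)
    ultimately show "eigenvalue (c \<cdot>\<^sub>m 1\<^sub>m n) e"
      unfolding eigenvalue_def eigenvector_def
      by (intro exI[of _ "unit_vec n 0"]) (simp add: eq)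
  qed
  then show ?thesis by (simp add: lambda_min_def)
qed

section \<open>Spectral gaps of sparse graphs\<close>

text \<open>This is the passage to degree matrix minus adjacency matrix; by symmetry both kinds of
  square terms have the same sum.\<close>

lemma laplacian_form_eq:
  fixes A :: "'a \<Rightarrow> 'a \<Rightarrow> real" and x :: "'a \<Rightarrow> real"
  assumes sym: "\<And>u w. A u w = A w u"
  shows "(\<Sum>u\<in>V. \<Sum>w\<in>V. A u w * (x u - x w)\<^sup>2) / 2
    = (\<Sum>u\<in>V. (\<Sum>w\<in>V. A u w) * (x u)\<^sup>2) - (\<Sum>u\<in>V. \<Sum>w\<in>V. A u w * (x u * x w))"
proof -
  have "(\<Sum>u\<in>V. \<Sum>w\<in>V. A u w * (x w)\<^sup>2) = (\<Sum>u\<in>V. \<Sum>w\<in>V. A u w * (x u)\<^sup>2)"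
    by (subst sum.swap) (simp add: sym)
  then have "(\<Sum>u\<in>V. \<Sum>w\<in>V. A u w * (x u - x w)\<^sup>2)
      = 2 * (\<Sum>u\<in>V. \<Sum>w\<in>V. A u w * (x u)\<^sup>2) - 2 * (\<Sum>u\<in>V. \<Sum>w\<in>V. A u w * (x u * x w))"
    by (simp add: power2_diff algebra_simps sum.distrib sum_subtractf sum_distrib_left)
  then show ?thesis
    unfolding sum_distrib_right by linarith
qed

text \<open>The factor of \<tau> in \<open>gap\<close> is the squared norm of \<open>x\<close> after
  subtracting its mean, so \<open>gap\<close> bounds the Laplacian below on the complement of the
  constants. Stated for all \<open>x\<close>, it accepts test vectors that are not centred.\<close>

locale graph_spectral_gap =
  fixes V :: "'a set" and A :: "'a \<Rightarrow> 'a \<Rightarrow> real" and \<tau> :: real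
  assumes finite_V: "finite V"
    and adj_sym: "A u w = A w u"
    and adj_01: "A u w \<in> {0, 1}"
    and adj_irrefl: "A u u = 0"
    and gap_pos: "0 < \<tau>"
    and gap: "\<tau> * ((\<Sum>u\<in>V. (x u)\<^sup>2) - (\<Sum>u\<in>V. x u)\<^sup>2 / card V)
      \<le> (\<Sum>u\<in>V. \<Sum>w\<in>V. A u w * (x u - x w)\<^sup>2) / 2"
begin

definition deg :: "'a set \<Rightarrow> 'a \<Rightarrow> real" where
  "deg L u = (\<Sum>w\<in>L. A u w)"

lemma adj_nonneg: "0 \<le> A u w"
  using adj_01[of u w] by auto

lemma adj_square: "A u w * A u w = A u w"
  using adj_01[of u w] by auto

lemma deg_nonneg: "0 \<le> deg L u"
  by (simp add: deg_def adj_nonneg sum_nonneg)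

lemma deg_mono: "L \<subseteq> V \<Longrightarrow> deg L u \<le> deg V u"
  unfolding deg_def using finite_V by (intro sum_mono2) (auto simp: adj_nonneg)

text \<open>The test vector is \<open>1\<close> at \<open>v\<close> and \<open>t\<close> at the neighbours of \<open>v\<close> in \<open>L\<close>.\<close>

lemma star_inequality:
  assumes v: "v \<in> V" and L: "L \<subseteq> V" and t: "0 \<le> t"
  shows "0 \<le> deg V v - \<tau> + t\<^sup>2 * (\<Sum>u\<in>L. A v u * (deg V u - \<tau>)) - 2 * t * deg L v
    + \<tau> * (1 + t * deg L v)\<^sup>2 / card V"
proof -
  define \<delta> where "\<delta> u = (if u = v then 1 else 0 :: real)" for u
  define y where "y u = (if u \<in> L then t * A v u else 0)" for u
  have y0: "y v = 0" by (simp add: y_def adj_irrefl)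
  have y_nonneg: "0 \<le> y u" for u by (simp add: y_def adj_nonneg t)
  have sum_\<delta>: "(\<Sum>u\<in>V. f u * \<delta> u) = f v" for f :: "'a \<Rightarrow> real"
    using finite_V v by (simp add: \<delta>_def if_distrib[of "(*) _"] cong: if_cong)
  have VL: "V \<inter> L = L" using L by blast
  have sum_y: "(\<Sum>u\<in>V. f u * y u) = t * (\<Sum>u\<in>L. f u * A v u)" for f :: "'a \<Rightarrow> real"
    using finite_V
    by (simp add: y_def if_distrib[of "(*) _"] sum_distrib_left mult_ac VL flip: sum.inter_restrict cong: if_cong)
  \<comment> \<open>Centre and leaves are disjoint since there are no loops, and the entries of
    \<open>A\<close> are 0 or 1, so squaring only adds a factor \<open>t\<close> on the
    leaves.\<close>
  have sq: "(\<delta> u + y u)\<^sup>2 = \<delta> u + t * y u" for u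
    using adj_square[of v u] y0 by (auto simp: \<delta>_def y_def power_mult_distrib power2_eq_square)
  have sum_sq: "(\<Sum>u\<in>V. f u * (\<delta> u + y u)\<^sup>2) = f v + t\<^sup>2 * (\<Sum>u\<in>L. A v u * f u)" for f :: "'a \<Rightarrow> real"
  proof -
    have "(\<Sum>u\<in>V. f u * (\<delta> u + y u)\<^sup>2) = (\<Sum>u\<in>V. f u * \<delta> u) + t * (\<Sum>u\<in>V. f u * y u)"
      unfolding sq sum_distrib_left sum.distrib[symmetric] by (simp add: algebra_simps)
    then show ?thesis
      unfolding sum_\<delta> sum_y by (simp add: power2_eq_square mult.assoc mult.commute[of "f _" "A v _"])
  qed
  have sum_x: "(\<Sum>u\<in>V. \<delta> u + y u) = 1 + t * deg L v"
    using sum_\<delta>[of "\<lambda>_. 1"] sum_y[of "\<lambda>_. 1"] by (simp add: sum.distrib deg_def)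
  have inner: "(\<Sum>w\<in>V. A u w * (\<delta> w + y w)) = A u v + (\<Sum>w\<in>V. A u w * y w)" for u
    using sum_\<delta>[of "A u"] by (simp add: distrib_left sum.distrib)
  have adj_y: "(\<Sum>w\<in>V. A v w * y w) = t * deg L v"
    using sum_y[of "A v"] by (simp add: deg_def adj_square)
  \<comment> \<open>Edges between two leaves contribute a nonnegative amount to the adjacency form
    and are discarded; only the edges between centre and leaves are kept.\<close>
  have "2 * (t * deg L v)
      \<le> 2 * (t * deg L v) + (\<Sum>u\<in>V. y u * (\<Sum>w\<in>V. A u w * y w))"
    by (simp add: sum_nonneg adj_nonneg y_nonneg)
  also have "\<dots> = (\<Sum>u\<in>V. (\<delta> u + y u) * (A u v + (\<Sum>w\<in>V. A u w * y w)))"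
  proof -
    have "(\<Sum>u\<in>V. \<delta> u * (A u v + (\<Sum>w\<in>V. A u w * y w))) = t * deg L v"
      using sum_\<delta>[of "\<lambda>u. A u v + (\<Sum>w\<in>V. A u w * y w)"]
      by (simp add: mult.commute[of "\<delta> _"] adj_irrefl adj_y)
    moreover have "(\<Sum>u\<in>V. y u * A u v) = t * deg L v"
      using adj_y by (simp add: mult.commute adj_sym)
    ultimately show ?thesis
      by (simp add: distrib_left distrib_right sum.distrib)
  qed
  also have "\<dots> = (\<Sum>u\<in>V. \<Sum>w\<in>V. A u w * ((\<delta> u + y u) * (\<delta> w + y w)))"
    unfolding inner[symmetric] sum_distrib_left by (simp add: mult_ac)
  finally have cross: "2 * (t * deg L v) \<le> \<dots>" .
  have "\<tau> * ((1 + t\<^sup>2 * (\<Sum>u\<in>L. A v u)) - (1 + t * deg L v)\<^sup>2 / card V)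
      \<le> (deg V v + t\<^sup>2 * (\<Sum>u\<in>L. A v u * deg V u))
        - (\<Sum>u\<in>V. \<Sum>w\<in>V. A u w * ((\<delta> u + y u) * (\<delta> w + y w)))"
    using gap[of "\<lambda>u. \<delta> u + y u"] sum_sq[of "\<lambda>_. 1"] sum_sq[of "deg V"]
    unfolding laplacian_form_eq[of A, OF adj_sym] sum_x deg_def[symmetric] by (simp add: deg_def)
  with cross have "\<tau> * (1 + t\<^sup>2 * deg L v - (1 + t * deg L v)\<^sup>2 / card V)
      \<le> deg V v + t\<^sup>2 * (\<Sum>u\<in>L. A v u * deg V u) - 2 * (t * deg L v)"
    unfolding deg_def by linarith
  moreover have "(\<Sum>u\<in>L. A v u * (deg V u - \<tau>)) = (\<Sum>u\<in>L. A v u * deg V u) - deg L v * \<tau>"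
    unfolding deg_def[of L] by (simp add: right_diff_distrib sum_subtractf sum_distrib_right)
  ultimately show ?thesis
    by (simp only: right_diff_distrib distrib_left mult_ac) simp
qed

text \<open>The star without leaves: the test vector is the indicator of \<open>v\<close>.\<close>

lemma deg_lower_bound: "v \<in> V \<Longrightarrow> \<tau> - \<tau> / card V \<le> deg V v"
  using star_inequality[of v "{}" 0] by simp

text \<open>Double counting of the adjacencies between \<open>K\<close> and
  \<open>L\<close>.\<close>

lemma deg_swap: "sum (deg L) K = sum (deg K) L"
  unfolding deg_def by (subst sum.swap) (simp add: adj_sym)

text \<open>The size conditions on \<open>card V\<close> absorb all corrections of order
  \<open>\<tau> / card V\<close> that come from centring the test vectors.\<close>

lemma gap_lower_bound:
  fixes \<epsilon> :: real
  assumes eps: "0 < \<epsilon>" "\<epsilon> \<le> 1 / 32"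
    and total: "sum (deg V) V \<le> card V * ((1 + \<epsilon>) * \<tau>)"
    and N: "8 \<le> card V" "1 \<le> \<epsilon> * card V" "(2 + 1 / (8 * \<epsilon>))\<^sup>2 \<le> 2 * \<epsilon> * card V"
  shows "1 / (128 * \<epsilon>\<^sup>2) \<le> \<tau>"
proof -
  define N where "N = real (card V)"
  have N8: "8 \<le> N" and N1: "1 \<le> \<epsilon> * N" and N2: "(2 + 1 / (8 * \<epsilon>))\<^sup>2 \<le> 2 * \<epsilon> * N"
    using N by (auto simp: N_def)
  \<comment> \<open>The average degree exceeds \<tau> by at most \<open>\<epsilon> * \<tau>\<close>.
    The shift \<open>\<tau> / N\<close> that makes \<open>h\<close> nonnegative costs at most as
    much again, whence the factor 2.\<close>
  define \<gamma> where "\<gamma> = 2 * \<epsilon> * \<tau>"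
  define h where "h u = deg V u - \<tau> + \<tau> / N" for u
  define L where "L = {u \<in> V. deg V u \<le> \<tau> + 4 * \<gamma>}"
  define H where "H = V - L"
  \<comment> \<open>This value gives \<open>t\<^sup>2 * (4 * \<gamma>) = t\<close>, so the excess
    degrees of the leaves consume only half of the gain \<open>2 * t * deg L v\<close>.\<close>
  define t where "t = 1 / (4 * \<gamma>)"
  have \<gamma>: "0 < \<gamma>" and t: "0 < t" using eps gap_pos by (auto simp: \<gamma>_def t_def)
  have LV: "L \<subseteq> V" and HV: "H \<subseteq> V"
    by (auto simp: L_def H_def)
  have split: "(\<Sum>u\<in>V. f u) = (\<Sum>u\<in>L. f u) + (\<Sum>u\<in>H. f u)" for f :: "'a \<Rightarrow> real"
    unfolding H_def using sum.subset_diff[OF LV finite_V, of f] by simp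
  have h_nonneg: "0 \<le> h u" if "u \<in> V" for u
    using deg_lower_bound[OF that] by (simp add: h_def N_def)
  have "(\<Sum>u\<in>V. h u) = sum (deg V) V - N * \<tau> + \<tau>"
    using N8 by (simp add: h_def sum.distrib sum_subtractf N_def)
  also have "\<dots> \<le> N * (\<epsilon> * \<tau>) + \<tau>"
    using total by (simp add: N_def algebra_simps)
  also have "\<dots> \<le> N * \<gamma>"
    using mult_right_mono[OF N1, of \<tau>] gap_pos by (simp add: \<gamma>_def algebra_simps)
  finally have sum_h: "(\<Sum>u\<in>V. h u) \<le> N * \<gamma>" .
  have sum_h_sub: "(\<Sum>u\<in>K. h u) \<le> N * \<gamma>" if "K \<subseteq> V" for K
    using sum_mono2[OF finite_V that, of h] h_nonneg sum_h by force
  \<comment> \<open>Markov's inequality: at most a quarter of the vertices exceed the threshold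
    defining \<open>L\<close>.\<close>
  have "card H * (4 * \<gamma>) \<le> (\<Sum>u\<in>H. h u)"
  proof -
    have "4 * \<gamma> \<le> h u" if "u \<in> H" for u
      using that gap_pos N8 by (auto simp: H_def L_def h_def intro: add_increasing2)
    then show ?thesis using sum_bounded_below[of H "4 * \<gamma>" h] by simp
  qed
  with sum_h_sub[OF HV] have "card H * (4 * \<gamma>) \<le> N * \<gamma>" by linarith
  then have cardH: "card H \<le> N / 4" using \<gamma> by simp
  have "sum (deg V) H \<le> (\<Sum>u\<in>H. \<tau> + h u)"
    using gap_pos N8 by (intro sum_mono) (simp add: h_def)
  also have "\<dots> \<le> N * \<tau> / 4 + N * \<gamma>"
  proof -
    have "card H * \<tau> \<le> N / 4 * \<tau>" using cardH gap_pos by (intro mult_right_mono) auto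
    then show ?thesis using sum_h_sub[OF HV] by (simp add: sum.distrib)
  qed
  finally have sum_H: "sum (deg V) H \<le> N * \<tau> / 4 + N * \<gamma>" .
  have N\<tau>: "N * (\<tau> - \<tau> / N) = N * \<tau> - \<tau>" using N8 by (simp add: field_simps)
  \<comment> \<open>Ordered adjacent pairs are split by whether they meet \<open>H\<close>. Those
    that do number at most twice the degree sum over \<open>H\<close>, which leaves at least
    \<open>N * \<tau> / 4\<close> inside \<open>L\<close>.\<close>
  have "N * \<tau> - \<tau> \<le> sum (deg V) V"
    using sum_bounded_below[of V "\<tau> - \<tau> / N" "deg V"] deg_lower_bound N\<tau> by (simp add: N_def)
  also have "\<dots> = sum (deg L) L + sum (deg L) H + sum (deg V) H"
  proof -
    have "deg V u = deg L u + deg H u" for u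
      unfolding deg_def by (rule split)
    then show ?thesis using split[of "deg V"] by (simp add: sum.distrib deg_swap[of L H])
  qed
  finally have sum_V: "N * \<tau> - \<tau> \<le> sum (deg L) L + sum (deg L) H + sum (deg V) H" .
  have "sum (deg L) H \<le> sum (deg V) H"
    by (intro sum_mono deg_mono LV)
  with sum_V sum_H have "N * \<tau> - \<tau> - 2 * (N * \<tau> / 4 + N * \<gamma>) \<le> sum (deg L) L"
    by argo
  moreover have "N * \<tau> / 4 \<le> N * \<tau> - \<tau> - 2 * (N * \<tau> / 4 + N * \<gamma>)"
  proof -
    have "8 * \<tau> \<le> N * \<tau>" using N8 gap_pos by simp
    moreover have "N * \<gamma> \<le> N * \<tau> / 16"
      using mult_right_mono[OF eps(2), of "2 * (N * \<tau>)"] gap_pos N8 by (simp add: \<gamma>_def mult_ac)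
    ultimately show ?thesis by argo
  qed
  ultimately have LL: "N * \<tau> / 4 \<le> sum (deg L) L" by linarith
  have point: "t * deg L v \<le> h v + \<gamma>" if v: "v \<in> L" for v
  proof -
    have vV: "v \<in> V" using v LV by blast
    have "t\<^sup>2 * (\<Sum>u\<in>L. A v u * (deg V u - \<tau>)) \<le> t\<^sup>2 * (\<Sum>u\<in>L. A v u * (4 * \<gamma>))"
      by (intro mult_left_mono sum_mono) (auto simp: L_def adj_nonneg)
    also have "\<dots> = t\<^sup>2 * (4 * \<gamma>) * deg L v"
      by (simp add: deg_def flip: sum_distrib_right)
    also have "\<dots> = t * deg L v"
      using \<gamma> by (simp add: t_def power2_eq_square)
    finally have nb: "t\<^sup>2 * (\<Sum>u\<in>L. A v u * (deg V u - \<tau>)) \<le> t * deg L v" .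
    \<comment> \<open>Here \<open>t * \<tau> = 1 / (8 * \<epsilon>)\<close> and
      \<open>t * (4 * \<gamma>) = 1\<close>, so the third size condition is exactly what bounds the
      centring term by \<gamma>.\<close>
    have "deg L v \<le> \<tau> + 4 * \<gamma>"
      using deg_mono[OF LV, of v] v by (simp add: L_def)
    then have "t * deg L v \<le> t * (\<tau> + 4 * \<gamma>)" using t by simp
    also have "\<dots> = 1 + 1 / (8 * \<epsilon>)"
      using \<gamma> eps gap_pos by (simp add: t_def \<gamma>_def field_simps)
    finally have "(1 + t * deg L v)\<^sup>2 \<le> (2 + 1 / (8 * \<epsilon>))\<^sup>2"
      using t deg_nonneg[of L v] by (intro power_mono) auto
    also note N2
    finally have "\<tau> * (1 + t * deg L v)\<^sup>2 / N \<le> \<tau> * (2 * \<epsilon> * N) / N"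
      using gap_pos N8 by (intro divide_right_mono mult_left_mono) auto
    also have "\<dots> = \<gamma>" using N8 by (simp add: \<gamma>_def)
    finally have J: "\<tau> * (1 + t * deg L v)\<^sup>2 / N \<le> \<gamma>" .
    have "0 \<le> \<tau> / N" using gap_pos N8 by simp
    with star_inequality[OF vV LV, of t] nb J t show ?thesis
      by (simp add: h_def N_def)
  qed
  \<comment> \<open>Summing over the centres in \<open>L\<close> yields
    \<open>\<tau> / (16 * \<gamma>) \<le> 2 * \<gamma>\<close>, that is
    \<open>\<tau> \<le> 128 * \<epsilon>\<^sup>2 * \<tau>\<^sup>2\<close>.\<close>
  have "t * (N * \<tau> / 4) \<le> t * sum (deg L) L"
    using LL t by simp
  also have "\<dots> \<le> (\<Sum>u\<in>L. h u + \<gamma>)"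
    unfolding sum_distrib_left by (intro sum_mono point)
  also have "\<dots> \<le> N * \<gamma> + N * \<gamma>"
  proof -
    have "real (card L) \<le> N" unfolding N_def using card_mono[OF finite_V LV] by simp
    then have "card L * \<gamma> \<le> N * \<gamma>" using \<gamma> by simp
    then show ?thesis using sum_h_sub[OF LV] by (simp add: sum.distrib)
  qed
  finally have "N * (t * \<tau> / 4) \<le> N * (2 * \<gamma>)" by (simp add: algebra_simps)
  then have "t * \<tau> / 4 \<le> 2 * \<gamma>" using N8 by simp
  then show ?thesis
    using eps gap_pos by (simp add: t_def \<gamma>_def field_simps power2_eq_square)
qed

end

section \<open>The complete graph design\<close>

lemma weighted_gram_carrier: "weighted_gram d S c v \<in> carrier_mat d d"
  by (simp add: weighted_gram_def)

lemma weighted_gram_symmetric: "(weighted_gram d S c v)\<^sup>T = weighted_gram d S c v"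
  by (rule eq_matI) (auto simp: weighted_gram_def mult.commute)

lemma weighted_gram_form:
  assumes x: "x \<in> carrier_vec d"
  shows "x \<bullet> (weighted_gram d S c v *\<^sub>v x) = (\<Sum>i\<in>S. c i * (\<Sum>a<d. v i $ a * x $ a)\<^sup>2)"
proof -
  have "x \<bullet> (weighted_gram d S c v *\<^sub>v x)
      = (\<Sum>a<d. \<Sum>b<d. \<Sum>i\<in>S. c i * ((v i $ a * x $ a) * (v i $ b * x $ b)))"
    unfolding quadratic_form_eq_sum[OF weighted_gram_carrier x]
    by (simp add: weighted_gram_def sum_distrib_left sum_distrib_right mult_ac)
  also have "\<dots> = (\<Sum>a<d. \<Sum>i\<in>S. \<Sum>b<d. c i * ((v i $ a * x $ a) * (v i $ b * x $ b)))"
    by (intro sum.cong refl sum.swap)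
  also have "\<dots> = (\<Sum>i\<in>S. \<Sum>a<d. \<Sum>b<d. c i * ((v i $ a * x $ a) * (v i $ b * x $ b)))"
    by (rule sum.swap)
  also have "\<dots> = (\<Sum>i\<in>S. c i * (\<Sum>a<d. v i $ a * x $ a)\<^sup>2)"
    by (simp add: power2_eq_square sum_product flip: sum_distrib_left)
  finally show ?thesis .
qed

text \<open>The Rayleigh quotient at the first unit vector. This crude bound makes the set under the
  \<open>Sup\<close> in \<open>CP_E\<close> bounded above.\<close>

lemma lambda_min_weighted_gram_le:
  assumes "0 < d"
  shows "lambda_min (weighted_gram d S c v) \<le> (\<Sum>i\<in>S. c i * (v i $ 0)\<^sup>2)"
proof -
  have "(\<Sum>a<d. v i $ a * unit_vec d 0 $ a) = v i $ 0" for i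
  proof -
    have "(\<Sum>a<d. v i $ a * unit_vec d 0 $ a) = (\<Sum>a<d. if a = 0 then v i $ a else 0)"
      by (intro sum.cong) auto
    then show ?thesis using assms by simp
  qed
  then show ?thesis
    using lambda_min_le_rayleigh[OF weighted_gram_carrier weighted_gram_symmetric unit_vec_carrier,
        of d S c v 0] assms
    by (simp add: weighted_gram_form)
qed

lemma CP_E_ge:
  assumes d: "0 < d" and x: "(\<Sum>i = 1..n. x i) = real k" "\<And>i. i \<in> {1..n} \<Longrightarrow> 0 \<le> x i \<and> x i \<le> 1"
  shows "lambda_min (weighted_gram d {1..n} x v) \<le> CP_E d k n v"
  unfolding CP_E_def
proof (rule cSup_upper)
  show "bdd_above {lambda_min (weighted_gram d {1..n} x v) | x.
     (\<Sum>i = 1..n. x i) = real k \<and> (\<forall>i\<in>{1..n}. 0 \<le> x i \<and> x i \<le> 1)}"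
  proof (rule bdd_aboveI, clarify)
    fix x :: "nat \<Rightarrow> real" assume "\<forall>i\<in>{1..n}. 0 \<le> x i \<and> x i \<le> 1"
    then have "(\<Sum>i=1..n. x i * (v i $ 0)\<^sup>2) \<le> (\<Sum>i=1..n. (v i $ 0)\<^sup>2)"
      by (intro sum_mono mult_left_le_one_le) auto
    with lambda_min_weighted_gram_le[OF d]
    show "lambda_min (weighted_gram d {1..n} x v) \<le> (\<Sum>i=1..n. (v i $ 0)\<^sup>2)"
      by (rule order_trans)
  qed
qed (use x in blast)

lemma OPT_E_attained:
  assumes "k \<le> n"
  obtains S where "S \<subseteq> {1..n}" "card S = k"
    "OPT_E d k n v = lambda_min (weighted_gram d S (\<lambda>_. 1) v)"
proof -
  let ?F = "{S. S \<subseteq> {1..n} \<and> card S = k}"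
  let ?g = "\<lambda>S. lambda_min (weighted_gram d S (\<lambda>_. 1) v)"
  have "finite ?F" by (rule finite_subset[of _ "Pow {1..n}"]) auto
  moreover have "?F \<noteq> {}" using obtain_subset_with_card_n[of k "{1..n}"] assms by auto
  ultimately have "Max (?g ` ?F) \<in> ?g ` ?F" by (intro Max_in) auto
  moreover have "OPT_E d k n v = Max (?g ` ?F)"
    unfolding OPT_E_def by (rule arg_cong[of _ _ Max]) auto
  ultimately show thesis using that by auto
qed

section \<open>The design vectors and their Gram matrix\<close>

definition lower_pairs :: "nat \<Rightarrow> (nat \<times> nat) set" where
  "lower_pairs N = (SIGMA u:{..<N}. {..<u})"

lemma finite_lower_pairs [simp]: "finite (lower_pairs N)"
  by (auto simp: lower_pairs_def)

lemma sum_lower_pairs: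
  fixes g :: "nat \<Rightarrow> nat \<Rightarrow> real"
  assumes sym: "\<And>u w. g u w = g w u" and diag: "\<And>u. g u u = 0"
  shows "(\<Sum>(u, w)\<in>lower_pairs N. g u w) = (\<Sum>u<N. \<Sum>w<N. g u w) / 2"
proof -
  have "(\<Sum>u<N. \<Sum>w<N. g u w) = 2 * (\<Sum>u<N. \<Sum>w<u. g u w)"
  proof (induction N)
    case (Suc N)
    have "(\<Sum>u<N. g u N) = (\<Sum>u<N. g N u)" by (simp add: sym)
    with Suc show ?case by (simp add: sum.distrib diag)
  qed simp
  then show ?thesis by (simp add: lower_pairs_def sum.Sigma)
qed

lemma card_lower_pairs: "2 * real (card (lower_pairs N)) = real N * (real N - 1)"
proof -
  have "card (lower_pairs N) = (\<Sum>u<N. u)" by (simp add: lower_pairs_def)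
  moreover have "2 * real (\<Sum>u<N. u) = real N * (real N - 1)"
    by (induction N) (auto simp: algebra_simps)
  ultimately show ?thesis by simp
qed

text \<open>\<open>(0, 0)\<close> is not a lower pair, so it is free to index the all-ones vector.\<close>

definition design_index :: "nat \<Rightarrow> (nat \<times> nat) set" where
  "design_index N = insert (0, 0) (lower_pairs N)"

definition design_vec :: "nat \<Rightarrow> nat \<times> nat \<Rightarrow> real vec" where
  "design_vec N p = (if p = (0, 0) then vec N (\<lambda>_. 1)
    else unit_vec N (fst p) - unit_vec N (snd p))"

lemma zero_notin_lower_pairs [simp]: "(0, 0) \<notin> lower_pairs N"
  by (simp add: lower_pairs_def)

lemma finite_design_index [simp]: "finite (design_index N)"
  by (simp add: design_index_def)

lemma card_design_index: "2 * real (card (design_index N)) = real N * (real N - 1) + 2"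
  using card_lower_pairs[of N] by (simp add: design_index_def)

lemma design_vec_carrier: "design_vec N p \<in> carrier_vec N"
  by (simp add: design_vec_def)

lemma design_vec_pair:
  assumes "(u, w) \<in> lower_pairs N" "a < N"
  shows "design_vec N (u, w) $ a = of_bool (a = u) - of_bool (a = w)"
  using assms by (auto simp: design_vec_def lower_pairs_def)

lemma design_vec_pair_inner:
  assumes "(u, w) \<in> lower_pairs N"
  shows "(\<Sum>a<N. design_vec N (u, w) $ a * x a) = x u - x w"
proof -
  have "u < N" "w < N" using assms by (auto simp: lower_pairs_def)
  then show ?thesis
    using assms by (simp add: design_vec_pair left_diff_distrib sum_subtractf of_bool_def
        if_distrib[of "\<lambda>c. c * _"] cong: if_cong)
qed

text \<open>The pairs contribute the Laplacian of the complete graph, \<open>N\<close> times the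
  identity minus the all-ones matrix; the all-ones vector restores the missing matrix.\<close>

lemma design_gram:
  assumes f: "bij_betw f {1..n} (design_index N)"
  shows "weighted_gram N {1..n} (\<lambda>_. c) (\<lambda>i. design_vec N (f i)) = (c * N) \<cdot>\<^sub>m 1\<^sub>m N"
proof (rule eq_matI)
  fix a b assume "a < dim_row ((c * real N) \<cdot>\<^sub>m 1\<^sub>m N)" "b < dim_col ((c * real N) \<cdot>\<^sub>m 1\<^sub>m N)"
  then have ab: "a < N" "b < N" by auto
  define g where "g u w = (of_bool (a = u) - of_bool (a = w)) * (of_bool (b = u) - of_bool (b = w) :: real)" for u w
  have "(\<Sum>i=1..n. design_vec N (f i) $ a * design_vec N (f i) $ b)
      = (\<Sum>p\<in>design_index N. design_vec N p $ a * design_vec N p $ b)"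
    by (rule sum.reindex_bij_betw[OF f])
  also have "\<dots> = 1 + (\<Sum>p\<in>lower_pairs N. design_vec N p $ a * design_vec N p $ b)"
    using ab by (simp add: design_index_def) (simp add: design_vec_def)
  also have "(\<Sum>p\<in>lower_pairs N. design_vec N p $ a * design_vec N p $ b)
      = (\<Sum>(u, w)\<in>lower_pairs N. g u w)"
    using ab by (intro sum.cong) (auto simp: design_vec_pair g_def)
  also have "\<dots> = (\<Sum>u<N. \<Sum>w<N. g u w) / 2"
    by (rule sum_lower_pairs) (auto simp: g_def algebra_simps)
  \<comment> \<open>Of the four products in \<open>g\<close>, the two with equal indices give
    \<open>N\<close> each when \<open>a = b\<close>, and the two mixed ones give -1 each.\<close>
  also have "(\<Sum>u<N. \<Sum>w<N. g u w) = 2 * (real N * of_bool (a = b)) - 2"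
  proof -
    have 1: "(\<Sum>w<N. of_bool (a = w) * h w) = h a" "(\<Sum>w<N. of_bool (b = w) * h w) = h b" for h :: "nat \<Rightarrow> real"
      using ab by (simp_all add: of_bool_def if_distrib[of "\<lambda>c. c * _"] cong: if_cong)
    have "g u w = of_bool (a = u) * of_bool (b = u) - of_bool (a = u) * (of_bool (b = w) * 1)
        - of_bool (b = u) * (of_bool (a = w) * 1) + of_bool (a = w) * of_bool (b = w)" for u w
      by (simp add: g_def algebra_simps)
    then have "(\<Sum>w<N. g u w) = real N * (of_bool (a = u) * of_bool (b = u)) - of_bool (a = u) * 1
        - of_bool (b = u) * 1 + of_bool (b = a)" for u
      by (simp only: sum.distrib sum_subtractf sum_distrib_left[symmetric] 1) simp
    then show ?thesis
      by (simp only: sum.distrib sum_subtractf sum_distrib_left[symmetric] 1) (simp add: eq_commute)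
  qed
  finally have "(\<Sum>i=1..n. design_vec N (f i) $ a * design_vec N (f i) $ b) = real N * of_bool (a = b)"
    by argo
  then show "weighted_gram N {1..n} (\<lambda>_. c) (\<lambda>i. design_vec N (f i)) $$ (a, b)
      = ((c * N) \<cdot>\<^sub>m 1\<^sub>m N) $$ (a, b)"
    using ab by (simp add: weighted_gram_def flip: sum_distrib_left)
qed (auto simp: weighted_gram_def)

section \<open>Chosen design vectors as a graph\<close>

text \<open>The condition \<open>u \<noteq> w\<close> keeps \<open>(0, 0)\<close>, the index of the
  all-ones vector, from becoming a loop.\<close>

definition edge_adj :: "(nat \<times> nat) set \<Rightarrow> nat \<Rightarrow> nat \<Rightarrow> real" where
  "edge_adj E u w = of_bool (u \<noteq> w \<and> ((u, w) \<in> E \<or> (w, u) \<in> E))"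

lemma sum_edges:
  assumes E: "E \<subseteq> design_index N" and sym: "\<And>u w. g u w = g w u"
  shows "(\<Sum>(u, w)\<in>E \<inter> lower_pairs N. g u w) = (\<Sum>u<N. \<Sum>w<N. edge_adj E u w * g u w) / 2"
proof -
  have "(\<Sum>(u, w)\<in>E \<inter> lower_pairs N. g u w)
      = (\<Sum>p\<in>lower_pairs N. if p \<in> E then (case p of (u, w) \<Rightarrow> g u w) else 0)"
    by (subst Int_commute) (rule sum.inter_restrict, simp)
  also have "\<dots> = (\<Sum>(u, w)\<in>lower_pairs N. edge_adj E u w * g u w)"
    using E by (intro sum.cong) (auto simp: edge_adj_def design_index_def lower_pairs_def)
  also have "\<dots> = (\<Sum>u<N. \<Sum>w<N. edge_adj E u w * g u w) / 2"
    by (rule sum_lower_pairs) (auto simp: edge_adj_def sym)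
  finally show ?thesis .
qed

text \<open>Only an inequality, because \<open>E\<close> may contain \<open>(0, 0)\<close>, which is
  not an edge.\<close>

lemma sum_edge_adj_le:
  assumes E: "E \<subseteq> design_index N"
  shows "(\<Sum>u<N. \<Sum>w<N. edge_adj E u w) \<le> 2 * real (card E)"
proof -
  have "finite E" using E finite_subset by fastforce
  then have "card (E \<inter> lower_pairs N) \<le> card E" by (intro card_mono) auto
  then show ?thesis using sum_edges[OF E, of "\<lambda>_ _. 1"] by simp
qed

text \<open>Centring \<open>x\<close> leaves all differences unchanged and makes it orthogonal to
  the all-ones vector, so in the Rayleigh inequality only the edges of the graph remain.\<close>

lemma design_subset_spectral_gap:
  assumes f: "bij_betw f {1..n} (design_index N)" and S: "S \<subseteq> {1..n}"
    and N: "0 < N" and \<tau>: "0 < \<tau>"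
    and le: "\<tau> \<le> lambda_min (weighted_gram N S (\<lambda>_. 1) (\<lambda>i. design_vec N (f i)))"
  shows "graph_spectral_gap {..<N} (edge_adj (f ` S)) \<tau>"
proof
  fix x :: "nat \<Rightarrow> real"
  define E where "E = f ` S"
  have E: "E \<subseteq> design_index N"
    using f S by (auto simp: E_def bij_betw_def)
  have inj: "inj_on f S"
    using f S by (auto simp: bij_betw_def intro: inj_on_subset)
  define m where "m = (\<Sum>u<N. x u) / N"
  define y where "y = vec N (\<lambda>u. x u - m)"
  have y: "y \<in> carrier_vec N" by (simp add: y_def)
  have sum_y: "(\<Sum>u<N. y $ u) = 0"
    using N by (simp add: y_def sum_subtractf m_def)
  have "y \<bullet> y = (\<Sum>u<N. (x u - m)\<^sup>2)"
    by (simp add: y_def scalar_prod_def atLeast0LessThan power2_eq_square)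
  also have "\<dots> = (\<Sum>u<N. (x u)\<^sup>2) - 2 * m * (\<Sum>u<N. x u) + N * m\<^sup>2"
    by (simp add: power2_diff sum.distrib sum_subtractf sum_distrib_left mult_ac)
  also have "\<dots> = (\<Sum>u<N. (x u)\<^sup>2) - (\<Sum>u<N. x u)\<^sup>2 / N"
    using N by (simp add: m_def field_simps power2_eq_square)
  finally have yy: "y \<bullet> y = (\<Sum>u<N. (x u)\<^sup>2) - (\<Sum>u<N. x u)\<^sup>2 / N" .
  have "\<tau> * (y \<bullet> y) \<le> lambda_min (weighted_gram N S (\<lambda>_. 1) (\<lambda>i. design_vec N (f i))) * (y \<bullet> y)"
    using le by (intro mult_right_mono) (auto simp: scalar_prod_def sum_nonneg)
  also have "\<dots> \<le> (\<Sum>i\<in>S. (\<Sum>a<N. design_vec N (f i) $ a * y $ a)\<^sup>2)"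
    using lambda_min_le_rayleigh[OF weighted_gram_carrier weighted_gram_symmetric y,
        of S "\<lambda>_. 1" "\<lambda>i. design_vec N (f i)"]
    by (simp add: weighted_gram_form[OF y])
  also have "\<dots> = (\<Sum>p\<in>E. (\<Sum>a<N. design_vec N p $ a * y $ a)\<^sup>2)"
    by (simp add: E_def sum.reindex[OF inj])
  also have "\<dots> = (\<Sum>p\<in>E \<inter> lower_pairs N. (\<Sum>a<N. design_vec N p $ a * y $ a)\<^sup>2)"
  proof (rule sum.mono_neutral_right)
    show "finite E" using E finite_subset by fastforce
    have "(\<Sum>a<N. design_vec N (0, 0) $ a * y $ a) = 0"
      using sum_y by (simp add: design_vec_def)
    then show "\<forall>p\<in>E - E \<inter> lower_pairs N. (\<Sum>a<N. design_vec N p $ a * y $ a)\<^sup>2 = 0"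
      using E by (auto simp: design_index_def)
  qed auto
  also have "\<dots> = (\<Sum>(u, w)\<in>E \<inter> lower_pairs N. (x u - x w)\<^sup>2)"
    by (intro sum.cong) (auto simp: design_vec_pair_inner, auto simp: y_def lower_pairs_def)
  also have "\<dots> = (\<Sum>u<N. \<Sum>w<N. edge_adj E u w * (x u - x w)\<^sup>2) / 2"
    by (rule sum_edges[OF E]) (rule power2_commute)
  finally show "\<tau> * ((\<Sum>u<N. (x u)\<^sup>2) - (\<Sum>u<N. x u)\<^sup>2 / card {..<N})
      \<le> (\<Sum>u<N. \<Sum>w<N. edge_adj (f ` S) u w * (x u - x w)\<^sup>2) / 2"
    by (simp add: yy E_def)
qed (use \<tau> in \<open>auto simp: edge_adj_def\<close>)

text \<open>A gap of at most \<open>1 + \<epsilon>\<close> would give a graph with spectral gap at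
  least \<tau> and degree sum at most \<open>2 * k\<close>. Then \<open>gap_lower_bound\<close>
  forces \<open>2 * k / N\<close> to be at least \<open>1 / (128 * \<epsilon>\<^sup>2)\<close>,
  against the bound on \<open>k\<close>.\<close>

lemma design_integrality_gap:
  fixes \<epsilon> :: real
  assumes eps: "0 < \<epsilon>" "\<epsilon> \<le> 1 / 32"
    and N: "8 \<le> N" "1 \<le> \<epsilon> * N" "(2 + 1 / (8 * \<epsilon>))\<^sup>2 \<le> 2 * \<epsilon> * N"
    and f: "bij_betw f {1..n} (design_index N)"
    and k: "0 < k" "k \<le> n" "k < 1 / 256 * N / \<epsilon>\<^sup>2"
  shows "(1 + \<epsilon>) * OPT_E N k n (\<lambda>i. design_vec N (f i)) < CP_E N k n (\<lambda>i. design_vec N (f i))"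
proof (rule ccontr)
  let ?v = "\<lambda>i. design_vec N (f i)"
  assume "\<not> ?thesis"
  then have contr: "CP_E N k n ?v \<le> (1 + \<epsilon>) * OPT_E N k n ?v" by simp
  have n: "2 * real n = real N * (real N - 1) + 2"
    using card_design_index[of N] bij_betw_same_card[OF f] by simp
  have npos: "0 < n" using k by simp
  \<comment> \<open>The right side is the value of the uniform solution \<open>k / n\<close>; there
    are at most \<open>N\<^sup>2 / 2\<close> vectors.\<close>
  have "2 * real k / N \<le> (k / n) * N"
  proof -
    have "2 * real n = N * real N - N + 2" using n by (simp add: right_diff_distrib)
    then have "2 * real n \<le> N * real N" using N(1) by linarith
    then have "2 * real n * k \<le> N * real N * k" by (intro mult_right_mono) auto
    then show ?thesis using npos N(1) by (simp add: field_simps)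
  qed
  also have "\<dots> = lambda_min (weighted_gram N {1..n} (\<lambda>_. k / n) ?v)"
    unfolding design_gram[OF f] using N(1) by (simp add: lambda_min_smult_one)
  also have "\<dots> \<le> CP_E N k n ?v"
    using N(1) npos k by (intro CP_E_ge) auto
  finally have CP: "2 * real k / N \<le> CP_E N k n ?v" .
  obtain S where S: "S \<subseteq> {1..n}" "card S = k"
    "OPT_E N k n ?v = lambda_min (weighted_gram N S (\<lambda>_. 1) ?v)"
    using OPT_E_attained[OF k(2)] by blast
  define \<tau> where "\<tau> = 2 * real k / N / (1 + \<epsilon>)"
  have \<tau>: "0 < \<tau>" using k N(1) eps by (simp add: \<tau>_def)
  have "\<tau> \<le> lambda_min (weighted_gram N S (\<lambda>_. 1) ?v)"
  proof -
    have "2 * real k / N \<le> OPT_E N k n ?v * (1 + \<epsilon>)"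
      using CP contr by (simp only: mult.commute order_trans)
    then show ?thesis
      unfolding \<tau>_def S(3)[symmetric] using eps by (simp only: pos_divide_le_eq add_pos_pos zero_less_one)
  qed
  then interpret graph_spectral_gap "{..<N}" "edge_adj (f ` S)" \<tau>
    using N(1) by (intro design_subset_spectral_gap[OF f S(1) _ \<tau>]) auto
  have "f ` S \<subseteq> design_index N"
    using f S(1) by (auto simp: bij_betw_def)
  then have "sum (deg {..<N}) {..<N} \<le> 2 * real (card (f ` S))"
    unfolding deg_def by (rule sum_edge_adj_le)
  also have "\<dots> \<le> 2 * real k"
    using card_image_le[of S f] S finite_subset by fastforce
  also have "\<dots> = card {..<N} * ((1 + \<epsilon>) * \<tau>)"
    using N(1) eps by (simp add: \<tau>_def)
  finally have "1 / (128 * \<epsilon>\<^sup>2) \<le> \<tau>"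
    using eps N by (intro gap_lower_bound) auto
  also have "\<tau> \<le> 2 * real k / N"
    using mult_left_mono[of 1 "1 + \<epsilon>" \<tau>] \<tau> eps by (simp add: \<tau>_def)
  also have "\<dots> < 1 / (128 * \<epsilon>\<^sup>2)"
    using k(3) N(1) eps by (simp add: field_simps)
  finally show False by simp
qed

theorem theoremC1:
  shows "\<exists>c::real. c > 0 \<and> (\<exists>\<epsilon>\<^sub>0::real. \<epsilon>\<^sub>0 > 0 \<and>
    (\<forall>\<epsilon>::real. 0 < \<epsilon> \<and> \<epsilon> < \<epsilon>\<^sub>0 \<longrightarrow>
      (\<exists>d\<^sub>0::nat. \<forall>d::nat. d \<ge> d\<^sub>0 \<longrightarrow>
        (\<forall>k::nat. 0 < k \<and> real k < c * real d / \<epsilon>\<^sup>2 \<longrightarrow>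
          (\<exists>(n::nat) (v :: nat \<Rightarrow> real vec). n \<ge> k \<and> (\<forall>i\<in>{1..n}. v i \<in> carrier_vec d) \<and>
            CP_E d k n v > (1 + \<epsilon>) * OPT_E d k n v)))))"
proof (rule exI[of _ "1 / 256"], intro conjI, simp, rule exI[of _ "1 / 32"], intro conjI, simp,
    intro allI impI, elim conjE)
  fix \<epsilon> :: real assume eps: "0 < \<epsilon>" "\<epsilon> < 1 / 32"
  \<comment> \<open>The first three summands supply the size conditions of
    \<open>design_integrality_gap\<close>; the last, together with the 8, gives
    \<open>1 / \<epsilon>\<^sup>2 \<le> d - 1\<close>, which ensures
    \<open>k \<le> n\<close>.\<close>
  define B where "B = 8 + 1 / \<epsilon> + (2 + 1 / (8 * \<epsilon>))\<^sup>2 / (2 * \<epsilon>) + 1 / \<epsilon>\<^sup>2"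
  show "\<exists>d\<^sub>0::nat. \<forall>d::nat. d \<ge> d\<^sub>0 \<longrightarrow> (\<forall>k::nat. 0 < k \<and> real k < 1 / 256 * real d / \<epsilon>\<^sup>2 \<longrightarrow>
      (\<exists>(n::nat) (v :: nat \<Rightarrow> real vec). n \<ge> k \<and> (\<forall>i\<in>{1..n}. v i \<in> carrier_vec d) \<and>
        CP_E d k n v > (1 + \<epsilon>) * OPT_E d k n v))"
  proof (rule exI[of _ "nat \<lceil>B\<rceil>"], intro allI impI, elim conjE)
    fix d k :: nat
    assume d: "nat \<lceil>B\<rceil> \<le> d" and k: "0 < k" "real k < 1 / 256 * real d / \<epsilon>\<^sup>2"
    have B: "B \<le> d" using d by linarith
    have pos: "0 \<le> 1 / \<epsilon>" "0 \<le> (2 + 1 / (8 * \<epsilon>))\<^sup>2 / (2 * \<epsilon>)" "0 \<le> 1 / \<epsilon>\<^sup>2"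
      using eps by auto
    have 1: "8 \<le> d" and "1 / \<epsilon> \<le> d" "(2 + 1 / (8 * \<epsilon>))\<^sup>2 / (2 * \<epsilon>) \<le> d"
      and 4: "1 / \<epsilon>\<^sup>2 \<le> real d - 1"
      using B pos unfolding B_def by linarith+
    then have 2: "1 \<le> \<epsilon> * d" and 3: "(2 + 1 / (8 * \<epsilon>))\<^sup>2 \<le> 2 * \<epsilon> * d"
      using eps by (simp_all add: divide_le_eq mult_ac)
    define n where "n = card (design_index d)"
    obtain f where f: "bij_betw f {1..n} (design_index d)"
      using ex_bij_betw_nat_finite_1[of "design_index d"] by (auto simp: n_def)
    \<comment> \<open>The number of available vectors is quadratic in \<open>d\<close>, so it
      exceeds the admissible \<open>k\<close> once \<open>d\<close> is large compared with
      \<open>1 / \<epsilon>\<^sup>2\<close>.\<close>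
    have "real k \<le> d * (1 / \<epsilon>\<^sup>2) / 256" using k(2) by simp
    also have "\<dots> \<le> d * (real d - 1) / 256"
      using 4 by (intro divide_right_mono mult_left_mono) auto
    also have "\<dots> \<le> n"
    proof -
      have "0 \<le> d * (real d - 1)" using 1 by simp
      then show ?thesis using card_design_index[of d] unfolding n_def by linarith
    qed
    finally have "k \<le> n" by simp
    then show "\<exists>(n::nat) (v :: nat \<Rightarrow> real vec). n \<ge> k \<and> (\<forall>i\<in>{1..n}. v i \<in> carrier_vec d) \<and>
        CP_E d k n v > (1 + \<epsilon>) * OPT_E d k n v"
      using design_integrality_gap[OF eps(1) _ 1 2 3 f k(1) _ k(2)] eps(2) design_vec_carrier
      by (intro exI[of _ n] exI[of _ "\<lambda>i. design_vec d (f i)"]) auto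
  qed
qed

end
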